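(* Let $f^*(t)=\pi(t)\sum_{g=1}^G x_g^*(t)$ be the cost in slot $t$ under an optimal solution $(x_g^*(t))_{g,t}$ of the offline problem P1, and let $\hat f(t)=\pi(t)\sum_{g=1}^G \hat x_g(t)$ be the cost in slot $t$ under the online policy that in every slot $t$ uses the optimal solution $(\hat x_g(t))_g$ of P2. Then $$\lim_{T\to\infty}\frac1T\sum_{t=1}^T\mathbb E\big[\hat f(t)-f^*(t)\big]\le\frac{\tilde M}{V},\qquad \tilde M = M+\frac12\sum_{g=1}^G(\overline X_g)^2,$$ where $$M=\sum_{g=1}^G\Big(\frac{A_g^2}{2}+Q_gA_g+\frac{\alpha_gZ_g}{R_g}\Big)+\frac12\sum_{g=1}^G\max\Big\{\Big(\frac{\alpha_g}{R_g}\Big)^2,\overline X_g^2\Big\}.$$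
   Context: An aggregator serves electric vehicles (EVs) partitioned into groups $\mathcal S_1,\dots,\mathcal S_G$ according to parking duration. EV $v$ arrives at slot $T_v^{\rm a}$ with energy $E_v^{\rm a}$, departs at slot $T_v^{\rm d}$ with required energy $E_v^{\rm d}$, and has maximum charging power $P_v$; $\eta$ is the charging efficiency, $\Delta t$ the slot length, and $e_v(t)$ the energy level of $v$ in slot $t$. $R_g=T_v^{\rm d}-T_v^{\rm a}>0$ is the common parking duration of EVs in group $g$. The electricity price $\pi(t)\ge 0$ and the EV arrivals are random; $\mathbb E$ is expectation. Arrival rates: $a_g(t)=\sum_{v\in\mathcal S_g}a_v(t)$, where $a_v(t)=P_v$ if $T_v^{\rm a}\le t<T_v^{\rm a}+T_v^{\min}$, $a_v(t)=P_v^{\rm end}$ if $t=T_v^{\rm a}+T_v^{\min}$, and $a_v(t)=0$ otherwise. Here $T_v^{\min}$ is the charging time of $v$ at maximum power, namely the least integer larger than $E_v^{\rm c}/(P_v\eta)$ with $E_v^{\rm c}=E_v^{\rm d}-E_v^{\rm a}$ the energy to be charged, and $P_v^{\rm end}=(E_v^{\rm d}-E_v^{\rm a})/\eta-(T_v^{\min}-1)P_v$. Power bounds: $X_g(t)=\sum_{v\in\mathcal S_g}X_v(t)\ge 0$, where for $T_v^{\rm a}\le t<T_v^{\rm d}$ one has $X_v(t)=P_v$ if $e_v(t)\le E_v^{\rm d}-\eta P_v\Delta t$ and $X_v(t)=(E_v^{\rm d}-e_v(t))/(\eta\Delta t)$ if $e_v(t)>E_v^{\rm d}-\eta P_v\Delta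 t$; otherwise $X_v(t)=0$. The quantity $X_g(t)$ is treated as the given upper bound in slot $t$, the same in P1 and P2. Offline problem P1: choose $x_g(t)$ for all $g,t$ to minimize $\lim_{T\to\infty}\frac1T\sum_{t=1}^T\mathbb E[f(t)]$, $f(t)=\pi(t)\sum_{g=1}^Gx_g(t)$, subject to $\lim_{T\to\infty}\frac1T\sum_{t=1}^T\mathbb E[a_g(t)-x_g(t)]\le0$ for all $g$ and $0\le x_g(t)\le X_g(t)$ for all $g,t$. Virtual queues: with constants $\alpha_g>0$ and $\mathbb I_g(t)=1$ if $q_g(t)>0$, $\mathbb I_g(t)=0$ if $q_g(t)=0$, $$q_g(t+1)=\max\{q_g(t)-x_g(t),0\}+a_g(t),\qquad z_g(t+1)=\max\Big\{z_g(t)+\frac{\alpha_g}{R_g}\mathbb I_g(t)-x_g(t),0\Big\},$$ with nonnegative initial values. Online problem P2 (solved in each slot $t$, given the current $\pi(t),q_g(t),z_g(t)$, with the queues then updated using its solution $x_g(t)=\hat x_g(t)$): minimize $\sum_{g=1}^G(V\pi(t)-q_g(t)-z_g(t))x_g(t)+\sum_{g=1}^G\frac12x_g^2(t)$ subject to $0\le x_g(t)\le X_g(t)$ for all $g$. Here $V>0$ is a fixed constant. Constants (all assumed finite): $A_g$, $Q_g$, $Z_g$, $\overline X_g$ are the maxima over all time slots of $a_g(t)$, $q_g(t)$, $z_g(t)$, $X_g(t)$ respectively, the queues being those of the online policy. *)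

theory Defs
  imports "HOL-Probability.Probability_Measure"
begin

section \<open>Electric vehicles\<close>

text \<open>The data of one vehicle; slots are natural numbers, and the time horizon starts in slot 1.\<close>

record vehicle =
  arrival_slot :: nat
  departure_slot :: nat
  arrival_energy :: real
  departure_energy :: real
  max_power :: real

definition energy_demand :: "vehicle \<Rightarrow> real" where
  "energy_demand v = departure_energy v - arrival_energy v"

text \<open>\<open>floor x + 1\<close> is the least integer strictly larger than \<open>x\<close>.\<close>

definition min_charging_time :: "real \<Rightarrow> vehicle \<Rightarrow> int" where
  "min_charging_time \<eta> v = \<lfloor>energy_demand v / (max_power v * \<eta>)\<rfloor> + 1"

definition end_power :: "real \<Rightarrow> vehicle \<Rightarrow> real" where
  "end_power \<eta> v =
     (departure_energy v - arrival_energy v) / \<eta>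
       - (real_of_int (min_charging_time \<eta> v) - 1) * max_power v"

definition vehicle_arrival_rate :: "real \<Rightarrow> vehicle \<Rightarrow> nat \<Rightarrow> real" where
  "vehicle_arrival_rate \<eta> v t =
     (if int (arrival_slot v) \<le> int t
           \<and> int t < int (arrival_slot v) + min_charging_time \<eta> v then max_power v
      else if int t = int (arrival_slot v) + min_charging_time \<eta> v then end_power \<eta> v
      else 0)"

text \<open>\<open>en\<close> is the energy level of the vehicle in slot \<open>t\<close>, \<open>\<delta>\<close> the slot length.\<close>

definition vehicle_power_bound :: "real \<Rightarrow> real \<Rightarrow> vehicle \<Rightarrow> real \<Rightarrow> nat \<Rightarrow> real" where
  "vehicle_power_bound \<eta> \<delta> v en t =
     (if arrival_slot v \<le> t \<and> t < departure_slot v then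
        (if en \<le> departure_energy v - \<eta> * max_power v * \<delta> then max_power v
         else (departure_energy v - en) / (\<eta> * \<delta>))
      else 0)"

text \<open>
  Over an infinite horizon a group may contain infinitely many vehicles. If only finitely many
  vehicles arrive in each slot, then the summands below have finite support and \<open>infsum\<close> is an
  ordinary finite sum. In a scenario \<open>\<omega>\<close>, \<open>S g \<omega>\<close> is the set of vehicles of group \<open>g\<close>,
  \<open>veh v \<omega>\<close> the data of vehicle \<open>v\<close>, and \<open>e v t \<omega>\<close> its energy level in slot \<open>t\<close>.
\<close>

definition arrival_rate ::
  "real \<Rightarrow> (nat \<Rightarrow> 'w \<Rightarrow> 'v set) \<Rightarrow> ('v \<Rightarrow> 'w \<Rightarrow> vehicle) \<Rightarrow> nat \<Rightarrow> nat \<Rightarrow> 'w \<Rightarrow> real" where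
  "arrival_rate \<eta> S veh g t \<omega> = (\<Sum>\<^sub>\<infinity>v\<in>S g \<omega>. vehicle_arrival_rate \<eta> (veh v \<omega>) t)"

definition power_bound ::
  "real \<Rightarrow> real \<Rightarrow> (nat \<Rightarrow> 'w \<Rightarrow> 'v set) \<Rightarrow> ('v \<Rightarrow> 'w \<Rightarrow> vehicle) \<Rightarrow> ('v \<Rightarrow> nat \<Rightarrow> 'w \<Rightarrow> real)
     \<Rightarrow> nat \<Rightarrow> nat \<Rightarrow> 'w \<Rightarrow> real" where
  "power_bound \<eta> \<delta> S veh e g t \<omega> =
     (\<Sum>\<^sub>\<infinity>v\<in>S g \<omega>. vehicle_power_bound \<eta> \<delta> (veh v \<omega>) (e v t \<omega>) t)"

section \<open>The offline problem P1\<close>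

definition time_average :: "(nat \<Rightarrow> real) \<Rightarrow> nat \<Rightarrow> real" where
  "time_average y T = 1 / real T * (\<Sum>t=1..T. y t)"

definition slot_cost ::
  "nat \<Rightarrow> (nat \<Rightarrow> 'w \<Rightarrow> real) \<Rightarrow> (nat \<Rightarrow> nat \<Rightarrow> 'w \<Rightarrow> real) \<Rightarrow> nat \<Rightarrow> 'w \<Rightarrow> real" where
  "slot_cost G \<pi> x t \<omega> = \<pi> t \<omega> * (\<Sum>g=1..G. x g t \<omega>)"

definition P1_feasible ::
  "'w measure \<Rightarrow> nat \<Rightarrow> (nat \<Rightarrow> nat \<Rightarrow> 'w \<Rightarrow> real) \<Rightarrow> (nat \<Rightarrow> nat \<Rightarrow> 'w \<Rightarrow> real)
     \<Rightarrow> (nat \<Rightarrow> nat \<Rightarrow> 'w \<Rightarrow> real) \<Rightarrow> bool" where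
  "P1_feasible \<Omega> G a X x \<longleftrightarrow>
     (\<forall>g\<in>{1..G}. \<forall>t\<ge>1. x g t \<in> borel_measurable \<Omega>) \<and>
     (\<forall>g\<in>{1..G}. \<forall>t\<ge>1. \<forall>\<omega>\<in>space \<Omega>. 0 \<le> x g t \<omega> \<and> x g t \<omega> \<le> X g t \<omega>) \<and>
     (\<forall>g\<in>{1..G}. \<exists>l\<le>0.
        time_average (\<lambda>t. \<integral>\<omega>. (a g t \<omega> - x g t \<omega>) \<partial>\<Omega>) \<longlonglongrightarrow> l)"

text \<open>
  The objective value of \<open>x\<close> is \<open>c\<close>. The integral of a non-integrable function is 0 by
  convention, so integrability is required for the value to be meaningful.
\<close>

definition P1_value ::
  "'w measure \<Rightarrow> nat \<Rightarrow> (nat \<Rightarrow> 'w \<Rightarrow> real) \<Rightarrow> (nat \<Rightarrow> nat \<Rightarrow> 'w \<Rightarrow> real) \<Rightarrow> real \<Rightarrow> bool" where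
  "P1_value \<Omega> G \<pi> x c \<longleftrightarrow>
     (\<forall>t\<ge>1. integrable \<Omega> (slot_cost G \<pi> x t)) \<and>
     time_average (\<lambda>t. \<integral>\<omega>. slot_cost G \<pi> x t \<omega> \<partial>\<Omega>) \<longlonglongrightarrow> c"

definition P1_optimal ::
  "'w measure \<Rightarrow> nat \<Rightarrow> (nat \<Rightarrow> 'w \<Rightarrow> real) \<Rightarrow> (nat \<Rightarrow> nat \<Rightarrow> 'w \<Rightarrow> real)
     \<Rightarrow> (nat \<Rightarrow> nat \<Rightarrow> 'w \<Rightarrow> real) \<Rightarrow> (nat \<Rightarrow> nat \<Rightarrow> 'w \<Rightarrow> real) \<Rightarrow> bool" where
  "P1_optimal \<Omega> G \<pi> a X x \<longleftrightarrow>
     P1_feasible \<Omega> G a X x \<and>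
     (\<exists>c. P1_value \<Omega> G \<pi> x c \<and>
        (\<forall>y d. P1_feasible \<Omega> G a X y \<and> P1_value \<Omega> G \<pi> y d \<longrightarrow> c \<le> d))"

section \<open>The online problem P2 and the virtual queues\<close>

text \<open>In the next two definitions a single slot of a single scenario is considered.\<close>

definition P2_objective ::
  "nat \<Rightarrow> real \<Rightarrow> real \<Rightarrow> (nat \<Rightarrow> real) \<Rightarrow> (nat \<Rightarrow> real) \<Rightarrow> (nat \<Rightarrow> real) \<Rightarrow> real" where
  "P2_objective G V p q z x =
     (\<Sum>g=1..G. (V * p - q g - z g) * x g) + (\<Sum>g=1..G. 1 / 2 * (x g)\<^sup>2)"

definition P2_optimal ::
  "nat \<Rightarrow> real \<Rightarrow> real \<Rightarrow> (nat \<Rightarrow> real) \<Rightarrow> (nat \<Rightarrow> real) \<Rightarrow> (nat \<Rightarrow> real) \<Rightarrow> (nat \<Rightarrow> real) \<Rightarrow> bool" where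
  "P2_optimal G V p q z X x \<longleftrightarrow>
     is_arg_min (P2_objective G V p q z) (\<lambda>y. \<forall>g\<in>{1..G}. 0 \<le> y g \<and> y g \<le> X g) x"

definition online_policy ::
  "'w measure \<Rightarrow> nat \<Rightarrow> real \<Rightarrow> (nat \<Rightarrow> real) \<Rightarrow> (nat \<Rightarrow> nat) \<Rightarrow> (nat \<Rightarrow> 'w \<Rightarrow> real)
     \<Rightarrow> (nat \<Rightarrow> nat \<Rightarrow> 'w \<Rightarrow> real) \<Rightarrow> (nat \<Rightarrow> nat \<Rightarrow> 'w \<Rightarrow> real)
     \<Rightarrow> (nat \<Rightarrow> nat \<Rightarrow> 'w \<Rightarrow> real) \<Rightarrow> (nat \<Rightarrow> nat \<Rightarrow> 'w \<Rightarrow> real)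
     \<Rightarrow> (nat \<Rightarrow> nat \<Rightarrow> 'w \<Rightarrow> real) \<Rightarrow> bool" where
  "online_policy \<Omega> G V \<alpha> R \<pi> a X q z x \<longleftrightarrow>
     (\<forall>g\<in>{1..G}. q g 1 \<in> borel_measurable \<Omega> \<and> z g 1 \<in> borel_measurable \<Omega>) \<and>
     (\<forall>g\<in>{1..G}. \<forall>\<omega>\<in>space \<Omega>. 0 \<le> q g 1 \<omega> \<and> 0 \<le> z g 1 \<omega>) \<and>
     (\<forall>t\<ge>1. \<forall>\<omega>\<in>space \<Omega>.
        P2_optimal G V (\<pi> t \<omega>) (\<lambda>g. q g t \<omega>) (\<lambda>g. z g t \<omega>) (\<lambda>g. X g t \<omega>) (\<lambda>g. x g t \<omega>)) \<and>
     (\<forall>g\<in>{1..G}. \<forall>t\<ge>1. \<forall>\<omega>\<in>space \<Omega>.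
        q g (t + 1) \<omega> = max (q g t \<omega> - x g t \<omega>) 0 + a g t \<omega> \<and>
        z g (t + 1) \<omega> =
          max (z g t \<omega> + \<alpha> g / real (R g) * (if q g t \<omega> > 0 then 1 else 0) - x g t \<omega>) 0)"

section \<open>Peak values\<close>

text \<open>
  The peak of a random process is its supremum over all slots and all scenarios, a deterministic
  number. It is meaningful only if the process is bounded above, whence the predicate.
\<close>

definition finite_peak :: "'w measure \<Rightarrow> (nat \<Rightarrow> 'w \<Rightarrow> real) \<Rightarrow> bool" where
  "finite_peak \<Omega> Y \<longleftrightarrow> bdd_above ((\<lambda>(t, \<omega>). Y t \<omega>) ` ({1..} \<times> space \<Omega>))"

definition peak :: "'w measure \<Rightarrow> (nat \<Rightarrow> 'w \<Rightarrow> real) \<Rightarrow> real" where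
  "peak \<Omega> Y = (SUP (t, \<omega>)\<in>{1..} \<times> space \<Omega>. Y t \<omega>)"

end

theory Submission
  imports Defs
begin

text \<open>
  The argument is the drift-plus-penalty method with the Lyapunov function
  \<open>L(t) = 1/2 * (\<Sum>g. q\<^sub>g(t)\<^sup>2 + z\<^sub>g(t)\<^sup>2)\<close>. Expanding the squares in the queue recursions and replacing
  arrivals and queue lengths by their peaks bounds the drift of the online policy in every single
  scenario:
  \<open>L(t+1) - L(t) \<le> M - (\<Sum>g. (q\<^sub>g(t) + z\<^sub>g(t)) * x\<^sub>g(t)) + 1/2 * (\<Sum>g. x\<^sub>g(t)\<^sup>2)\<close>
  (lemma \<open>queue_pair_drift\<close>). After the penalty \<open>V * \<pi>(t) * (\<Sum>g. x\<^sub>g(t))\<close> is added to both sides, the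
  right-hand side is \<open>M\<close> plus exactly the objective of the online problem. As that objective is
  minimised, \<open>x\<close> may be replaced by any competitor \<open>y\<close> within the power bounds, in particular by
  the offline solution. The terms \<open>-(q\<^sub>g + z\<^sub>g) * y\<^sub>g\<close> are nonpositive and the terms \<open>1/2 * y\<^sub>g\<^sup>2\<close> are
  absorbed by the step from \<open>M\<close> to \<open>M + 1/2 * (\<Sum>g. Xbar\<^sub>g\<^sup>2)\<close>; hence, with \<open>y\<close> the offline solution,
  \<open>V * (f_on(t) - f_off(t)) \<le> Mtilde + L(t) - L(t+1)\<close>
  (lemma \<open>drift_plus_penalty\<close>). Taking expectations and averaging over \<open>t = 1, \<dots>, T\<close>, the Lyapunov
  terms telescope and contribute at most \<open>E[L(1)] / T\<close>, which vanishes in the limit.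

  Two points need care. Arrival rates have to be nonnegative, which follows from their definition in
  terms of the vehicles (lemma \<open>arrival_rate_nonneg\<close>). Expectations have to be meaningful: the
  online problem has a unique solution, the projection of \<open>q\<^sub>g + z\<^sub>g - V * \<pi>\<close> onto the interval
  \<open>{0..X\<^sub>g}\<close> (lemma \<open>P2_optimal_eq\<close>), so the queues and the online decisions are measurable, and the
  pathwise inequality bounds the online cost by an integrable function.
\<close>

section \<open>Nonnegativity of the arrival rates\<close>

lemma end_power_nonneg:
  assumes "\<eta> > 0" "max_power v > 0"
  shows "0 \<le> end_power \<eta> v"
proof -
  let ?r = "energy_demand v / (max_power v * \<eta>)"
  have "real_of_int \<lfloor>?r\<rfloor> * max_power v \<le> ?r * max_power v"
    using assms by (intro mult_right_mono) auto
  also have "\<dots> = energy_demand v / \<eta>"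
    using assms by (simp add: field_simps)
  finally show ?thesis
    by (simp add: end_power_def min_charging_time_def energy_demand_def)
qed

lemma vehicle_arrival_rate_nonneg:
  assumes "\<eta> > 0" "max_power v > 0"
  shows "0 \<le> vehicle_arrival_rate \<eta> v t"
  using assms end_power_nonneg[OF assms] by (simp add: vehicle_arrival_rate_def)

lemma arrival_rate_nonneg:
  assumes "\<eta> > 0" "\<And>v. v \<in> S g \<omega> \<Longrightarrow> max_power (veh v \<omega>) > 0"
  shows "0 \<le> arrival_rate \<eta> S veh g t \<omega>"
  unfolding arrival_rate_def
  using assms by (intro infsum_nonneg vehicle_arrival_rate_nonneg) auto

section \<open>The solution of the online problem\<close>

lemma P2_optimalD:
  assumes "P2_optimal G V p q z X x"
  shows "\<And>g. g \<in> {1..G} \<Longrightarrow> 0 \<le> x g \<and> x g \<le> X g"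
    and "\<And>y. (\<And>g. g \<in> {1..G} \<Longrightarrow> 0 \<le> y g \<and> y g \<le> X g) \<Longrightarrow>
           P2_objective G V p q z x \<le> P2_objective G V p q z y"
  using assms unfolding P2_optimal_def is_arg_min_linorder by auto

lemma nearest_point_interval_unique:
  fixes u w X :: real
  assumes "0 \<le> u" "u \<le> X" "(u - w)\<^sup>2 \<le> (max 0 (min X w) - w)\<^sup>2"
  shows "u = max 0 (min X w)"
proof -
  have "\<bar>u - w\<bar> \<le> \<bar>max 0 (min X w) - w\<bar>"
    using assms(3) by (simp add: abs_le_square_iff)
  then show ?thesis
    using assms(1,2) by (auto simp: max_def min_def abs_if split: if_splits)
qed

text \<open>
  The objective is separable, and up to a constant its \<open>g\<close>-th summand is half the squared distance
  from \<open>x g\<close> to \<open>q g + z g - V * p\<close>.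
\<close>

lemma P2_optimal_eq:
  assumes opt: "P2_optimal G V p q z X x" and g: "g \<in> {1..G}" and X: "0 \<le> X g"
  shows "x g = max 0 (min (X g) (q g + z g - V * p))"
proof -
  let ?w = "q g + z g - V * p"
  define c where "c = max 0 (min (X g) ?w)"
  define h where "h = (\<lambda>k u. (V * p - q k - z k) * u + 1 / 2 * u\<^sup>2)"
  have obj: "P2_objective G V p q z y = h g (y g) + (\<Sum>k\<in>{1..G} - {g}. h k (y k))" for y
    unfolding P2_objective_def sum.distrib[symmetric] h_def
    using g by (subst sum.remove[of _ g]) auto
  have "P2_objective G V p q z x \<le> P2_objective G V p q z (x(g := c))"
    using X P2_optimalD(1)[OF opt]
    by (intro P2_optimalD(2)[OF opt]) (auto simp: c_def)
  then have "h g (x g) \<le> h g c"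
    unfolding obj by simp
  moreover have "h g u = 1 / 2 * (u - ?w)\<^sup>2 - 1 / 2 * ?w\<^sup>2" for u
    unfolding h_def by (simp add: power2_eq_square algebra_simps)
  ultimately have "(x g - ?w)\<^sup>2 \<le> (c - ?w)\<^sup>2"
    by simp
  then show ?thesis
    using nearest_point_interval_unique[of "x g" "X g" ?w] P2_optimalD(1)[OF opt g]
    by (simp add: c_def)
qed

section \<open>The online queues\<close>

lemma online_policyD:
  assumes "online_policy \<Omega> G V \<alpha> R \<pi> a X q z x"
  shows "\<And>g. g \<in> {1..G} \<Longrightarrow> q g 1 \<in> borel_measurable \<Omega>"
    and "\<And>g. g \<in> {1..G} \<Longrightarrow> z g 1 \<in> borel_measurable \<Omega>"
    and "\<And>g \<omega>. g \<in> {1..G} \<Longrightarrow> \<omega> \<in> space \<Omega> \<Longrightarrow> 0 \<le> q g 1 \<omega>"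
    and "\<And>g \<omega>. g \<in> {1..G} \<Longrightarrow> \<omega> \<in> space \<Omega> \<Longrightarrow> 0 \<le> z g 1 \<omega>"
    and "\<And>t \<omega>. t \<ge> 1 \<Longrightarrow> \<omega> \<in> space \<Omega> \<Longrightarrow>
           P2_optimal G V (\<pi> t \<omega>) (\<lambda>g. q g t \<omega>) (\<lambda>g. z g t \<omega>) (\<lambda>g. X g t \<omega>) (\<lambda>g. x g t \<omega>)"
    and "\<And>g t \<omega>. g \<in> {1..G} \<Longrightarrow> t \<ge> 1 \<Longrightarrow> \<omega> \<in> space \<Omega> \<Longrightarrow>
           q g (Suc t) \<omega> = max (q g t \<omega> - x g t \<omega>) 0 + a g t \<omega>"
    and "\<And>g t \<omega>. g \<in> {1..G} \<Longrightarrow> t \<ge> 1 \<Longrightarrow> \<omega> \<in> space \<Omega> \<Longrightarrow>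
           z g (Suc t) \<omega> =
             max (z g t \<omega> + \<alpha> g / real (R g) * (if q g t \<omega> > 0 then 1 else 0) - x g t \<omega>) 0"
  using assms unfolding online_policy_def by auto

lemma online_queues_nonneg:
  assumes on: "online_policy \<Omega> G V \<alpha> R \<pi> a X q z x"
    and a: "\<And>t. t \<ge> 1 \<Longrightarrow> 0 \<le> a g t \<omega>"
    and g: "g \<in> {1..G}" and \<omega>: "\<omega> \<in> space \<Omega>" and t: "t \<ge> 1"
  shows "0 \<le> q g t \<omega> \<and> 0 \<le> z g t \<omega>"
  using t
proof (induction t rule: nat_induct_at_least)
  case base
  show ?case using online_policyD(3,4)[OF on g \<omega>] by simp
next
  case (Suc n)
  then show ?case
    using online_policyD(6,7)[OF on g Suc.hyps \<omega>] a[OF Suc.hyps] by auto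
qed

lemma online_policy_measurable:
  assumes on: "online_policy \<Omega> G V \<alpha> R \<pi> a X q z x"
    and \<pi>: "\<And>t. t \<ge> 1 \<Longrightarrow> \<pi> t \<in> borel_measurable \<Omega>"
    and a: "\<And>t. t \<ge> 1 \<Longrightarrow> a g t \<in> borel_measurable \<Omega>"
    and X: "\<And>t. t \<ge> 1 \<Longrightarrow> X g t \<in> borel_measurable \<Omega>"
    and X_nonneg: "\<And>t \<omega>. t \<ge> 1 \<Longrightarrow> \<omega> \<in> space \<Omega> \<Longrightarrow> 0 \<le> X g t \<omega>"
    and g: "g \<in> {1..G}" and t: "t \<ge> 1"
  shows "q g t \<in> borel_measurable \<Omega>" "z g t \<in> borel_measurable \<Omega>" "x g t \<in> borel_measurable \<Omega>"
proof -
  have x: "x g t \<in> borel_measurable \<Omega>"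
    if "t \<ge> 1" and [measurable]: "q g t \<in> borel_measurable \<Omega>" "z g t \<in> borel_measurable \<Omega>" for t
  proof -
    note [measurable] = \<pi>[OF that(1)] X[OF that(1)]
    have "(\<lambda>\<omega>. max 0 (min (X g t \<omega>) (q g t \<omega> + z g t \<omega> - V * \<pi> t \<omega>))) \<in> borel_measurable \<Omega>"
      by measurable
    moreover have "x g t \<omega> = max 0 (min (X g t \<omega>) (q g t \<omega> + z g t \<omega> - V * \<pi> t \<omega>))"
      if "\<omega> \<in> space \<Omega>" for \<omega>
      using P2_optimal_eq[OF online_policyD(5)[OF on \<open>t \<ge> 1\<close> that] g] X_nonneg[OF \<open>t \<ge> 1\<close> that]
      by simp
    ultimately show ?thesis
      by (simp cong: measurable_cong)
  qed
  have qz: "q g t \<in> borel_measurable \<Omega> \<and> z g t \<in> borel_measurable \<Omega>"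
    using t
  proof (induction t rule: nat_induct_at_least)
    case base
    show ?case using online_policyD(1,2)[OF on g] by simp
  next
    case (Suc n)
    then have [measurable]: "q g n \<in> borel_measurable \<Omega>" "z g n \<in> borel_measurable \<Omega>"
      "x g n \<in> borel_measurable \<Omega>" "a g n \<in> borel_measurable \<Omega>"
      using x a by auto
    have "(\<lambda>\<omega>. max (q g n \<omega> - x g n \<omega>) 0 + a g n \<omega>) \<in> borel_measurable \<Omega>"
      by measurable
    moreover have "(\<lambda>\<omega>. max (z g n \<omega> + \<alpha> g / real (R g) * (if q g n \<omega> > 0 then 1 else 0) - x g n \<omega>) 0)
        \<in> borel_measurable \<Omega>"
      by measurable
    ultimately show ?case
      using online_policyD(6,7)[OF on g Suc.hyps] by (simp cong: measurable_cong)
  qed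
  then show "q g t \<in> borel_measurable \<Omega>" "z g t \<in> borel_measurable \<Omega>" "x g t \<in> borel_measurable \<Omega>"
    using x t by auto
qed

lemma le_peak:
  assumes "finite_peak \<Omega> Y" "t \<ge> 1" "\<omega> \<in> space \<Omega>"
  shows "Y t \<omega> \<le> peak \<Omega> Y"
proof -
  have "(\<lambda>(t, \<omega>). Y t \<omega>) (t, \<omega>) \<le> peak \<Omega> Y"
    unfolding peak_def
    using assms by (intro cSUP_upper) (auto simp: finite_peak_def)
  then show ?thesis by simp
qed

section \<open>Lyapunov drift in a single slot\<close>

text \<open>The quadratic Lyapunov function of the queue lengths in one slot of one scenario.\<close>

definition lyapunov :: "nat \<Rightarrow> (nat \<Rightarrow> real) \<Rightarrow> (nat \<Rightarrow> real) \<Rightarrow> real" where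
  "lyapunov G q z = (\<Sum>g=1..G. ((q g)\<^sup>2 + (z g)\<^sup>2) / 2)"

lemma lyapunov_nonneg: "0 \<le> lyapunov G q z"
  unfolding lyapunov_def by (intro sum_nonneg) auto

lemma lyapunov_le:
  assumes "\<And>g. g \<in> {1..G} \<Longrightarrow> 0 \<le> q g \<and> q g \<le> Q g"
    and "\<And>g. g \<in> {1..G} \<Longrightarrow> 0 \<le> z g \<and> z g \<le> Z g"
  shows "lyapunov G q z \<le> lyapunov G Q Z"
  unfolding lyapunov_def
  by (intro sum_mono divide_right_mono add_mono power_mono) (auto simp: assms)

lemma max_zero_square_le: "(max u (0::real))\<^sup>2 \<le> u\<^sup>2"
  by (simp add: max_def)

text \<open>
  Here \<open>i\<close> is the indicator of a nonempty first queue and \<open>c\<close> the increment \<open>\<alpha>\<^sub>g / R\<^sub>g\<close> of the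
  second one.
\<close>

lemma queue_pair_drift:
  fixes q z a x c i A Q Z X :: real
  assumes q: "0 \<le> q" "q \<le> Q" and z: "0 \<le> z" "z \<le> Z" and a: "0 \<le> a" "a \<le> A"
    and x: "0 \<le> x" "x \<le> X" and c: "0 \<le> c" and i: "i = 0 \<or> i = 1"
  shows "((max (q - x) 0 + a)\<^sup>2 + (max (z + c * i - x) 0)\<^sup>2) / 2
           \<le> (q\<^sup>2 + z\<^sup>2) / 2 + (A\<^sup>2 / 2 + Q * A + c * Z + 1 / 2 * max (c\<^sup>2) (X\<^sup>2))
             - (q + z) * x + 1 / 2 * x\<^sup>2"
proof -
  have "a * max (q - x) 0 \<le> A * Q"
    using q a x by (intro mult_mono) auto
  moreover have "a\<^sup>2 \<le> A\<^sup>2"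
    using a by (intro power_mono)
  ultimately have "(max (q - x) 0 + a)\<^sup>2 \<le> (q - x)\<^sup>2 + 2 * (Q * A) + A\<^sup>2"
    using max_zero_square_le[of "q - x"] unfolding power2_sum by (simp add: algebra_simps)
  moreover have "(max (z + c * i - x) 0)\<^sup>2 \<le> z\<^sup>2 + 2 * (c * Z) - 2 * (z * x) + max (c\<^sup>2) (X\<^sup>2)"
  proof -
    have "\<bar>c * i - x\<bar> \<le> max \<bar>c\<bar> \<bar>X\<bar>"
      using c x i by auto
    then have "(c * i - x)\<^sup>2 \<le> max (c\<^sup>2) (X\<^sup>2)"
      by (auto simp: le_max_iff_disj abs_le_square_iff)
    moreover have "c * i * z \<le> c * Z"
      using c z i by (auto intro: mult_left_mono)
    moreover have "(z + c * i - x)\<^sup>2 = z\<^sup>2 + 2 * (c * i * z) - 2 * (z * x) + (c * i - x)\<^sup>2"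
      by (simp add: power2_eq_square algebra_simps)
    ultimately show ?thesis
      using max_zero_square_le[of "z + c * i - x"] by linarith
  qed
  ultimately show ?thesis
    by (simp add: power2_diff field_simps)
qed

text \<open>
  The inequality holds in one slot of one scenario, against an arbitrary competitor \<open>y\<close> within
  the power bounds. The increments \<open>c\<close> and indicators \<open>i\<close> are as in the preceding lemma.
\<close>

lemma drift_plus_penalty:
  fixes q z q' z' a x y X c i A Q Z Xbar :: "nat \<Rightarrow> real"
  assumes opt: "P2_optimal G V p q z X x"
    and y: "\<And>g. g \<in> {1..G} \<Longrightarrow> 0 \<le> y g \<and> y g \<le> X g"
    and q: "\<And>g. g \<in> {1..G} \<Longrightarrow> 0 \<le> q g \<and> q g \<le> Q g"
    and z: "\<And>g. g \<in> {1..G} \<Longrightarrow> 0 \<le> z g \<and> z g \<le> Z g"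
    and a: "\<And>g. g \<in> {1..G} \<Longrightarrow> 0 \<le> a g \<and> a g \<le> A g"
    and X: "\<And>g. g \<in> {1..G} \<Longrightarrow> X g \<le> Xbar g"
    and c: "\<And>g. g \<in> {1..G} \<Longrightarrow> 0 \<le> c g"
    and i: "\<And>g. g \<in> {1..G} \<Longrightarrow> i g = 0 \<or> i g = 1"
    and q': "\<And>g. g \<in> {1..G} \<Longrightarrow> q' g = max (q g - x g) 0 + a g"
    and z': "\<And>g. g \<in> {1..G} \<Longrightarrow> z' g = max (z g + c g * i g - x g) 0"
  shows "V * (p * (\<Sum>g=1..G. x g) - p * (\<Sum>g=1..G. y g))
           \<le> (\<Sum>g=1..G. (A g)\<^sup>2 / 2 + Q g * A g + c g * Z g)
              + 1 / 2 * (\<Sum>g=1..G. max ((c g)\<^sup>2) ((Xbar g)\<^sup>2)) + 1 / 2 * (\<Sum>g=1..G. (Xbar g)\<^sup>2)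
              + lyapunov G q z - lyapunov G q' z'"
proof -
  define D where
    "D g = (A g)\<^sup>2 / 2 + Q g * A g + c g * Z g + 1 / 2 * max ((c g)\<^sup>2) ((Xbar g)\<^sup>2)" for g
  have obj: "P2_objective G V p q z u
      = V * (p * (\<Sum>g=1..G. u g)) + (\<Sum>g=1..G. - ((q g + z g) * u g) + 1 / 2 * (u g)\<^sup>2)" for u
    unfolding P2_objective_def
    by (simp add: sum.distrib[symmetric] sum_distrib_left algebra_simps)
  have "lyapunov G q' z'
      \<le> (\<Sum>g=1..G. ((q g)\<^sup>2 + (z g)\<^sup>2) / 2 + D g + (- ((q g + z g) * x g) + 1 / 2 * (x g)\<^sup>2))"
    unfolding lyapunov_def
  proof (intro sum_mono)
    fix g assume g: "g \<in> {1..G}"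
    have "0 \<le> x g \<and> x g \<le> Xbar g"
      using P2_optimalD(1)[OF opt g] X[OF g] by auto
    then show "((q' g)\<^sup>2 + (z' g)\<^sup>2) / 2
        \<le> ((q g)\<^sup>2 + (z g)\<^sup>2) / 2 + D g + (- ((q g + z g) * x g) + 1 / 2 * (x g)\<^sup>2)"
      using queue_pair_drift[of "q g" "Q g" "z g" "Z g" "a g" "A g" "x g" "Xbar g" "c g" "i g"]
        q[OF g] z[OF g] a[OF g] c[OF g] i[OF g]
      unfolding q'[OF g] z'[OF g] D_def by linarith
  qed
  also have "\<dots> = lyapunov G q z + (\<Sum>g=1..G. D g)
      + (P2_objective G V p q z x - V * (p * (\<Sum>g=1..G. x g)))"
    unfolding obj lyapunov_def by (simp add: sum.distrib)
  finally have drift: "V * (p * (\<Sum>g=1..G. x g)) + lyapunov G q' z'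
      \<le> lyapunov G q z + (\<Sum>g=1..G. D g) + P2_objective G V p q z x"
    by simp
  have "P2_objective G V p q z x \<le> P2_objective G V p q z y"
    using y by (rule P2_optimalD(2)[OF opt])
  also have "\<dots> \<le> V * (p * (\<Sum>g=1..G. y g)) + (\<Sum>g=1..G. 1 / 2 * (Xbar g)\<^sup>2)"
    unfolding obj
  proof (intro add_left_mono sum_mono)
    fix g assume g: "g \<in> {1..G}"
    have "0 \<le> (q g + z g) * y g"
      using q[OF g] z[OF g] y[OF g] by auto
    moreover have "(y g)\<^sup>2 \<le> (Xbar g)\<^sup>2"
      using y[OF g] X[OF g] by (intro power_mono) auto
    ultimately show "- ((q g + z g) * y g) + 1 / 2 * (y g)\<^sup>2 \<le> 1 / 2 * (Xbar g)\<^sup>2"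
      by linarith
  qed
  finally show ?thesis
    using drift unfolding D_def
    by (simp add: sum.distrib sum_distrib_left sum_divide_distrib right_diff_distrib)
qed

section \<open>Time averages with a telescoping error\<close>

lemma time_average_telescope_le:
  fixes y L :: "nat \<Rightarrow> real"
  assumes y: "\<And>t. t \<ge> 1 \<Longrightarrow> y t \<le> C + L t - L (Suc t)"
    and L: "\<And>t. t \<ge> 1 \<Longrightarrow> 0 \<le> L t" and T: "T \<ge> 1"
  shows "time_average y T \<le> C + L 1 / real T"
proof -
  have "(\<Sum>t=1..T. y t) \<le> real T * C + L 1 - L (Suc T)"
    using T
  proof (induction T rule: nat_induct_at_least)
    case base
    show ?case using y[of 1] by simp
  next
    case (Suc n)
    then show ?case using y[of "Suc n"] by (simp add: algebra_simps)
  qed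
  also have "\<dots> \<le> real T * C + L 1"
    using L[of "Suc T"] by simp
  finally show ?thesis
    using T by (simp add: time_average_def field_simps)
qed

lemma limsup_time_average_telescope_le:
  fixes y L :: "nat \<Rightarrow> real"
  assumes "\<And>t. t \<ge> 1 \<Longrightarrow> y t \<le> C + L t - L (Suc t)" "\<And>t. t \<ge> 1 \<Longrightarrow> 0 \<le> L t"
  shows "limsup (\<lambda>T. ereal (time_average y T)) \<le> ereal C"
proof -
  have "(\<lambda>T. C + L 1 / real T) \<longlonglongrightarrow> C + 0"
    by (intro tendsto_intros lim_const_over_n)
  then have "(\<lambda>T. ereal (C + L 1 / real T)) \<longlonglongrightarrow> ereal C"
    by simp
  then have "limsup (\<lambda>T. ereal (C + L 1 / real T)) = ereal C"
    by (intro lim_imp_Limsup) simp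
  moreover have "limsup (\<lambda>T. ereal (time_average y T)) \<le> limsup (\<lambda>T. ereal (C + L 1 / real T))"
    using time_average_telescope_le[where y = y and C = C and L = L, OF assms]
    by (intro Limsup_mono eventually_mono[OF eventually_ge_at_top[of 1]]) auto
  ultimately show ?thesis by simp
qed

lemma lim_le_if_limsup_le:
  fixes u :: "nat \<Rightarrow> real"
  assumes "convergent u" "limsup (\<lambda>n. ereal (u n)) \<le> ereal C"
  shows "lim u \<le> C"
proof -
  have "(\<lambda>n. ereal (u n)) \<longlonglongrightarrow> ereal (lim u)"
    using assms(1) by (simp add: convergent_LIMSEQ_iff)
  then have "limsup (\<lambda>n. ereal (u n)) = ereal (lim u)"
    by (intro lim_imp_Limsup) simp
  then show ?thesis using assms(2) by simp
qed

section \<open>The performance guarantee\<close>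

theorem proposition1:
  fixes \<Omega> :: "'w measure"
    and G :: nat
    and S :: "nat \<Rightarrow> 'w \<Rightarrow> 'v set"
    and veh :: "'v \<Rightarrow> 'w \<Rightarrow> vehicle"
    and e :: "'v \<Rightarrow> nat \<Rightarrow> 'w \<Rightarrow> real"
    and R :: "nat \<Rightarrow> nat"
    and \<alpha> A Q Z Xbar :: "nat \<Rightarrow> real"
    and \<eta> \<delta> V M Mtilde :: real
    and \<pi> :: "nat \<Rightarrow> 'w \<Rightarrow> real"
    and a X q z x_on x_off :: "nat \<Rightarrow> nat \<Rightarrow> 'w \<Rightarrow> real"
    and gap :: "nat \<Rightarrow> real"
  assumes "prob_space \<Omega>"
    and "\<eta> > 0" and "\<delta> > 0" and "V > 0"
    and "\<And>g. g \<in> {1..G} \<Longrightarrow> \<alpha> g > 0"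
    and "\<And>g. g \<in> {1..G} \<Longrightarrow> R g > 0"
    \<comment> \<open>vehicles\<close>
    and "\<And>\<omega>. \<omega> \<in> space \<Omega> \<Longrightarrow> disjoint_family_on (\<lambda>g. S g \<omega>) {1..G}"
    and "\<And>g \<omega> v. g \<in> {1..G} \<Longrightarrow> \<omega> \<in> space \<Omega> \<Longrightarrow> v \<in> S g \<omega> \<Longrightarrow>
           max_power (veh v \<omega>) > 0 \<and>
           departure_slot (veh v \<omega>) = arrival_slot (veh v \<omega>) + R g"
    and "\<And>g \<omega> t. g \<in> {1..G} \<Longrightarrow> \<omega> \<in> space \<Omega> \<Longrightarrow>
           finite {v \<in> S g \<omega>. arrival_slot (veh v \<omega>) = t}"
    \<comment> \<open>price, arrival rates and power bounds\<close>
    and "a = arrival_rate \<eta> S veh"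
    and "X = power_bound \<eta> \<delta> S veh e"
    and "\<And>t. t \<ge> 1 \<Longrightarrow> \<pi> t \<in> borel_measurable \<Omega>"
    and "\<And>g t. g \<in> {1..G} \<Longrightarrow> t \<ge> 1 \<Longrightarrow> a g t \<in> borel_measurable \<Omega>"
    and "\<And>g t. g \<in> {1..G} \<Longrightarrow> t \<ge> 1 \<Longrightarrow> X g t \<in> borel_measurable \<Omega>"
    and "\<And>t \<omega>. t \<ge> 1 \<Longrightarrow> \<omega> \<in> space \<Omega> \<Longrightarrow> \<pi> t \<omega> \<ge> 0"
    and "\<And>g t \<omega>. g \<in> {1..G} \<Longrightarrow> t \<ge> 1 \<Longrightarrow> \<omega> \<in> space \<Omega> \<Longrightarrow> X g t \<omega> \<ge> 0"
    \<comment> \<open>the two solutions\<close>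
    and "P1_optimal \<Omega> G \<pi> a X x_off"
    and "online_policy \<Omega> G V \<alpha> R \<pi> a X q z x_on"
    \<comment> \<open>constants\<close>
    and "\<And>g. g \<in> {1..G} \<Longrightarrow> finite_peak \<Omega> (a g) \<and> A g = peak \<Omega> (a g)"
    and "\<And>g. g \<in> {1..G} \<Longrightarrow> finite_peak \<Omega> (q g) \<and> Q g = peak \<Omega> (q g)"
    and "\<And>g. g \<in> {1..G} \<Longrightarrow> finite_peak \<Omega> (z g) \<and> Z g = peak \<Omega> (z g)"
    and "\<And>g. g \<in> {1..G} \<Longrightarrow> finite_peak \<Omega> (X g) \<and> Xbar g = peak \<Omega> (X g)"
    and "M = (\<Sum>g=1..G. (A g)\<^sup>2 / 2 + Q g * A g + \<alpha> g * Z g / real (R g))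
             + 1 / 2 * (\<Sum>g=1..G. max ((\<alpha> g / real (R g))\<^sup>2) ((Xbar g)\<^sup>2))"
    and "Mtilde = M + 1 / 2 * (\<Sum>g=1..G. (Xbar g)\<^sup>2)"
    and "gap = time_average
           (\<lambda>t. \<integral>\<omega>. (slot_cost G \<pi> x_on t \<omega> - slot_cost G \<pi> x_off t \<omega>) \<partial>\<Omega>)"
  shows "(convergent gap \<longrightarrow> lim gap \<le> Mtilde / V) \<and>
         limsup (\<lambda>T. ereal (gap T)) \<le> ereal (Mtilde / V)"
proof -
  interpret prob_space \<Omega> by fact
  note V = \<open>V > 0\<close>
  note off = \<open>P1_optimal \<Omega> G \<pi> a X x_off\<close>
  note on = \<open>online_policy \<Omega> G V \<alpha> R \<pi> a X q z x_on\<close>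
  note Xpos = assms(16)
  have peaks: "a g t \<omega> \<le> A g" "q g t \<omega> \<le> Q g" "z g t \<omega> \<le> Z g" "X g t \<omega> \<le> Xbar g"
    if "g \<in> {1..G}" "t \<ge> 1" "\<omega> \<in> space \<Omega>" for g t \<omega>
    using assms(19-22)[OF that(1)] le_peak[OF _ that(2,3)] by auto
  have a_nonneg: "0 \<le> a g t \<omega>" if "g \<in> {1..G}" "\<omega> \<in> space \<Omega>" for g t \<omega>
    unfolding \<open>a = arrival_rate \<eta> S veh\<close>
    using assms(8)[OF that] \<open>\<eta> > 0\<close> by (intro arrival_rate_nonneg) auto
  have qz_nonneg: "0 \<le> q g t \<omega> \<and> 0 \<le> z g t \<omega>"
    if "g \<in> {1..G}" "t \<ge> 1" "\<omega> \<in> space \<Omega>" for g t \<omega>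
    using online_queues_nonneg[OF on a_nonneg that(1,3,2)] that by simp
  have meas: "q g t \<in> borel_measurable \<Omega>" "z g t \<in> borel_measurable \<Omega>"
      "x_on g t \<in> borel_measurable \<Omega>" if "g \<in> {1..G}" "t \<ge> 1" for g t
    using online_policy_measurable[OF on assms(12) assms(13) assms(14) Xpos that(1,2)] that(1)
    by auto
  have x_on_nonneg: "0 \<le> x_on g t \<omega>" if "g \<in> {1..G}" "t \<ge> 1" "\<omega> \<in> space \<Omega>" for g t \<omega>
    using P2_optimalD(1)[OF online_policyD(5)[OF on that(2,3)] that(1)] by simp
  have x_off_bounds: "0 \<le> x_off g t \<omega> \<and> x_off g t \<omega> \<le> X g t \<omega>"
    if "g \<in> {1..G}" "t \<ge> 1" "\<omega> \<in> space \<Omega>" for g t \<omega>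
    using off that by (auto simp: P1_optimal_def P1_feasible_def)
  define L where "L t \<omega> = lyapunov G (\<lambda>g. q g t \<omega>) (\<lambda>g. z g t \<omega>)" for t \<omega>
  have pathwise: "V * (slot_cost G \<pi> x_on t \<omega> - slot_cost G \<pi> x_off t \<omega>)
      \<le> Mtilde + L t \<omega> - L (Suc t) \<omega>" if t: "t \<ge> 1" and \<omega>: "\<omega> \<in> space \<Omega>" for t \<omega>
  proof -
    have "V * (slot_cost G \<pi> x_on t \<omega> - slot_cost G \<pi> x_off t \<omega>)
      \<le> (\<Sum>g=1..G. (A g)\<^sup>2 / 2 + Q g * A g + \<alpha> g / real (R g) * Z g)
        + 1 / 2 * (\<Sum>g=1..G. max ((\<alpha> g / real (R g))\<^sup>2) ((Xbar g)\<^sup>2))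
        + 1 / 2 * (\<Sum>g=1..G. (Xbar g)\<^sup>2) + L t \<omega> - L (Suc t) \<omega>"
      unfolding slot_cost_def L_def
    proof (rule drift_plus_penalty[OF online_policyD(5)[OF on t \<omega>],
          where a = "\<lambda>g. a g t \<omega>" and i = "\<lambda>g. if q g t \<omega> > 0 then 1 else 0"])
      fix g assume g: "g \<in> {1..G}"
      show "0 \<le> \<alpha> g / real (R g)"
        using assms(5)[OF g] by simp
    qed (use x_off_bounds qz_nonneg a_nonneg peaks online_policyD(6,7)[OF on] t \<omega> in auto)
    then show ?thesis
      unfolding \<open>Mtilde = _\<close> \<open>M = _\<close> by simp
  qed
  have L_nonneg: "0 \<le> L t \<omega>" for t \<omega>
    by (simp add: L_def lyapunov_nonneg)
  have L_int: "integrable \<Omega> (L t)" if "t \<ge> 1" for t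
  proof (rule integrable_const_bound)
    show "AE \<omega> in \<Omega>. norm (L t \<omega>) \<le> lyapunov G Q Z"
      using that qz_nonneg peaks L_nonneg by (auto simp: L_def intro!: AE_I2 lyapunov_le)
    show "L t \<in> borel_measurable \<Omega>"
      unfolding L_def lyapunov_def
      using meas[OF _ that]
      by (intro borel_measurable_sum borel_measurable_divide borel_measurable_add
          borel_measurable_power borel_measurable_const)
  qed
  have off_int: "integrable \<Omega> (slot_cost G \<pi> x_off t)" if "t \<ge> 1" for t
    using off that by (auto simp: P1_optimal_def P1_value_def)
  have on_int: "integrable \<Omega> (slot_cost G \<pi> x_on t)" if t: "t \<ge> 1" for t
  proof (rule Bochner_Integration.integrable_bound)
    show "integrable \<Omega> (\<lambda>\<omega>. slot_cost G \<pi> x_off t \<omega> + (Mtilde + L t \<omega>) / V)"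
      using off_int[OF t] L_int[OF t] by (intro Bochner_Integration.integrable_add integrable_divide) auto
    show "slot_cost G \<pi> x_on t \<in> borel_measurable \<Omega>"
      unfolding slot_cost_def
      using meas[OF _ t] assms(12)[OF t]
      by (intro borel_measurable_times borel_measurable_sum)
    show "AE \<omega> in \<Omega>. norm (slot_cost G \<pi> x_on t \<omega>)
        \<le> norm (slot_cost G \<pi> x_off t \<omega> + (Mtilde + L t \<omega>) / V)"
    proof (rule AE_I2)
      fix \<omega> assume \<omega>: "\<omega> \<in> space \<Omega>"
      have "V * (slot_cost G \<pi> x_on t \<omega> - slot_cost G \<pi> x_off t \<omega>) \<le> Mtilde + L t \<omega>"
        using pathwise[OF t \<omega>] L_nonneg[of "Suc t" \<omega>] by linarith
      then have "slot_cost G \<pi> x_on t \<omega> \<le> slot_cost G \<pi> x_off t \<omega> + (Mtilde + L t \<omega>) / V"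
        using V by (simp add: field_simps)
      moreover have "0 \<le> slot_cost G \<pi> x_on t \<omega>"
        unfolding slot_cost_def
        using assms(15)[OF t \<omega>] x_on_nonneg[OF _ t \<omega>] by (intro mult_nonneg_nonneg sum_nonneg)
      ultimately show "norm (slot_cost G \<pi> x_on t \<omega>)
          \<le> norm (slot_cost G \<pi> x_off t \<omega> + (Mtilde + L t \<omega>) / V)"
        by simp
    qed
  qed
  have expected: "(\<integral>\<omega>. (slot_cost G \<pi> x_on t \<omega> - slot_cost G \<pi> x_off t \<omega>) \<partial>\<Omega>)
      \<le> Mtilde / V + (\<integral>\<omega>. L t \<omega> \<partial>\<Omega>) / V - (\<integral>\<omega>. L (Suc t) \<omega> \<partial>\<Omega>) / V" if t: "t \<ge> 1" for t
  proof -
    have int: "integrable \<Omega> (L t)" "integrable \<Omega> (L (Suc t))"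
      using L_int t by auto
    have "(\<integral>\<omega>. (slot_cost G \<pi> x_on t \<omega> - slot_cost G \<pi> x_off t \<omega>) \<partial>\<Omega>)
        \<le> (\<integral>\<omega>. (Mtilde + L t \<omega> - L (Suc t) \<omega>) / V \<partial>\<Omega>)"
    proof (rule integral_mono)
      fix \<omega> assume "\<omega> \<in> space \<Omega>"
      from pathwise[OF t this]
      show "slot_cost G \<pi> x_on t \<omega> - slot_cost G \<pi> x_off t \<omega> \<le> (Mtilde + L t \<omega> - L (Suc t) \<omega>) / V"
        using V by (simp add: field_simps)
    qed (use int on_int[OF t] off_int[OF t] in auto)
    also have "\<dots> = (Mtilde + (\<integral>\<omega>. L t \<omega> \<partial>\<Omega>) - (\<integral>\<omega>. L (Suc t) \<omega> \<partial>\<Omega>)) / V"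
      using int by (simp add: prob_space)
    finally show ?thesis
      by (simp add: add_divide_distrib diff_divide_distrib)
  qed
  have "limsup (\<lambda>T. ereal (gap T)) \<le> ereal (Mtilde / V)"
    unfolding \<open>gap = _\<close>
    using expected L_nonneg V
    by (intro limsup_time_average_telescope_le[where L = "\<lambda>t. (\<integral>\<omega>. L t \<omega> \<partial>\<Omega>) / V"])
       (auto intro: integral_nonneg)
  then show ?thesis
    using lim_le_if_limsup_le by blast
qed

end
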